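(* Let $k,\ell$ be positive integers with $k\geq 3$, and let $a=\frac{k^{k}}{k^{k}-k!}$. Then $p(n)=\sqrt[k]{\frac{\log_{a}n}{n}}$ is a sharp threshold function for the property $rx_{k,\ell}(G_{n,p})\leq k$. That is, there exist positive constants $c$ and $C$ such that: for every $p'(n)\leq c\,p(n)$, almost surely $rx_{k,\ell}(G_{n,p'(n)})> k$; and for every $p''(n)\geq C\,p(n)$, almost surely $rx_{k,\ell}(G_{n,p''(n)})\leq k$.
   Context: All graphs are finite, simple and undirected. An edge-coloring of a graph $G$ assigns colors to edges (adjacent edges may share a color). A tree in an edge-colored graph is a rainbow tree if no two of its edges have the same color. For $S\subseteq V(G)$, a rainbow $S$-tree is a rainbow tree (subgraph of $G$) containing all vertices of $S$. Rainbow $S$-trees $T_1,\dots,T_\ell$ are internally disjoint if for all $i\neq j$, $E(T_i)\cap E(T_j)=\emptyset$ and $V(T_i)\cap V(T_j)=S$. For positive integers $k,\ell$, the $(k,\ell)$-rainbow index $rx_{k,\ell}(G)$ is the minimum number of colors in an edge-coloring of $G$ such that for every set $S$ of $k$ vertices of $G$ there exist $\ell$ internally disjoint rainbow $S$-trees (if no such coloring exists, the property $rx_{k,\ell}(G)\le k$ fails). $G_{n,p}$ denotes the random graph on $n$ vertices in which each edge is present independently with probability $p$. An event $E(n)$ holds almost surely if $\Pr[E(n)]\to 1$ as $n\to\infty$. $\log_a$ denotes the logarithm to base $a$. *)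

theory Defs
  imports
    "HOL-Probability.Probability"
    "HOL-Library.Extended_Nat"
begin

section \<open>Finite simple graphs and trees\<close>

text \<open>A graph is a pair of a vertex set and a set of two-element vertex sets.\<close>

type_synonym 'v graph = "'v set \<times> 'v set set"

abbreviation verts :: "'v graph \<Rightarrow> 'v set" where
  "verts \<equiv> fst"

abbreviation edges :: "'v graph \<Rightarrow> 'v set set" where
  "edges \<equiv> snd"

definition simple_graph :: "'v graph \<Rightarrow> bool" where
  "simple_graph G \<longleftrightarrow> finite (verts G) \<and> (\<forall>e\<in>edges G. e \<subseteq> verts G \<and> card e = 2)"

definition subgraph :: "'v graph \<Rightarrow> 'v graph \<Rightarrow> bool" where
  "subgraph H G \<longleftrightarrow> simple_graph H \<and> verts H \<subseteq> verts G \<and> edges H \<subseteq> edges G"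

definition connected_graph :: "'v graph \<Rightarrow> bool" where
  "connected_graph G \<longleftrightarrow> verts G \<noteq> {} \<and>
     (\<forall>u\<in>verts G. \<forall>v\<in>verts G. (u, v) \<in> {(x, y). {x, y} \<in> edges G}\<^sup>*)"

definition cycle :: "'v graph \<Rightarrow> 'v list \<Rightarrow> bool" where
  "cycle G xs \<longleftrightarrow> length xs \<ge> 3 \<and> distinct xs \<and>
     (\<forall>i<length xs. {xs ! i, xs ! (Suc i mod length xs)} \<in> edges G)"

definition tree :: "'v graph \<Rightarrow> bool" where
  "tree T \<longleftrightarrow> simple_graph T \<and> connected_graph T \<and> (\<nexists>xs. cycle T xs)"

section \<open>The \<open>(k, l)\<close>-rainbow index\<close>

text \<open>
  An edge-coloring is a function on all two-element sets of which only the values on the edges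
  of the graph matter; the number of colors is the number of values taken on the edges.
\<close>

definition rainbow_tree :: "('v set \<Rightarrow> nat) \<Rightarrow> 'v graph \<Rightarrow> bool" where
  "rainbow_tree col T \<longleftrightarrow> tree T \<and> inj_on col (edges T)"

definition rainbow_S_tree :: "'v graph \<Rightarrow> ('v set \<Rightarrow> nat) \<Rightarrow> 'v set \<Rightarrow> 'v graph \<Rightarrow> bool" where
  "rainbow_S_tree G col S T \<longleftrightarrow> subgraph T G \<and> rainbow_tree col T \<and> S \<subseteq> verts T"

definition internally_disjoint :: "'v set \<Rightarrow> nat \<Rightarrow> (nat \<Rightarrow> 'v graph) \<Rightarrow> bool" where
  "internally_disjoint S l T \<longleftrightarrow>
     (\<forall>i<l. \<forall>j<l. i \<noteq> j \<longrightarrow>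
        edges (T i) \<inter> edges (T j) = {} \<and> verts (T i) \<inter> verts (T j) = S)"

definition rainbow_coloring :: "nat \<Rightarrow> nat \<Rightarrow> 'v graph \<Rightarrow> ('v set \<Rightarrow> nat) \<Rightarrow> bool" where
  "rainbow_coloring k l G col \<longleftrightarrow>
     (\<forall>S. S \<subseteq> verts G \<and> card S = k \<longrightarrow>
        (\<exists>T. (\<forall>i<l. rainbow_S_tree G col S (T i)) \<and> internally_disjoint S l T))"

text \<open>The value is \<open>\<infinity>\<close>, the infimum of the empty set, if there is no suitable coloring.\<close>

definition rainbow_index :: "nat \<Rightarrow> nat \<Rightarrow> 'v graph \<Rightarrow> enat" where
  "rainbow_index k l G = (INF col\<in>{col. rainbow_coloring k l G col}. enat (card (col ` edges G)))"

section \<open>Random graphs\<close>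

definition random_graph :: "nat \<Rightarrow> real \<Rightarrow> nat graph pmf" where
  "random_graph n p =
     (let E = {e. e \<subseteq> {..<n} \<and> card e = 2}
      in map_pmf (\<lambda>present. ({..<n}, {e \<in> E. present e}))
           (Pi_pmf E False (\<lambda>_. bernoulli_pmf p)))"

definition almost_surely :: "(nat \<Rightarrow> 'a pmf) \<Rightarrow> ('a \<Rightarrow> bool) \<Rightarrow> bool" where
  "almost_surely X P \<longleftrightarrow> (\<lambda>n. measure_pmf.prob (X n) {x. P x}) \<longlonglongrightarrow> 1"

definition threshold_base :: "nat \<Rightarrow> real" where
  "threshold_base k = real (k ^ k) / (real (k ^ k) - fact k)"

definition threshold :: "nat \<Rightarrow> nat \<Rightarrow> real" where
  "threshold k n = root k (log (threshold_base k) (real n) / real n)"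

end

theory Submission
  imports Defs "HOL-Real_Asymp.Real_Asymp"
begin

text \<open>
  Above the threshold, color the edges uniformly at random with \<open>k\<close> colors, independently of the
  graph. For a fixed \<open>k\<close>-set \<open>S\<close>, split the other vertices into \<open>l\<close> parts of equal size. The stars
  from \<open>S\<close> to different vertices use different edges, so the probability that a part contains no
  center of a rainbow star on \<open>S\<close> is at most \<open>(1 - (p / k) ^ k) ^ ((n - k) div l)\<close>. For large \<open>C\<close>
  this beats the number of sets \<open>S\<close>, and stars with different centers are internally disjoint.

  Below the threshold, \<open>k\<close> colors only allow trees with at most \<open>k\<close> edges, and such a tree on an
  independent \<open>k\<close>-set \<open>S\<close> is a star centered at a common neighbour of \<open>S\<close>. Take about \<open>n powr (1 / (4k))\<close>
  disjoint \<open>k\<close>-sets. Almost surely their union \<open>U\<close> spans no edge. The events that the individual sets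
  have a common neighbour outside \<open>U\<close> are independent, and for small \<open>c\<close> almost surely one of them
  fails.
\<close>

section \<open>Union bound and independence in finite product distributions\<close>

lemma prob_UN_le:
  assumes "finite I" "\<And>i. i \<in> I \<Longrightarrow> measure_pmf.prob M (A i) \<le> b"
  shows "measure_pmf.prob M (\<Union>i\<in>I. A i) \<le> real (card I) * b"
proof -
  have "measure_pmf.prob M (\<Union>i\<in>I. A i) \<le> (\<Sum>i\<in>I. measure_pmf.prob M (A i))"
    by (rule measure_pmf.finite_measure_subadditive_finite) (use assms in auto)
  also have "\<dots> \<le> real (card I) * b"
    using assms by (intro sum_bounded_above) auto
  finally show ?thesis .
qed

lemma prob_not: "measure_pmf.prob M {x. \<not> P x} = 1 - measure_pmf.prob M {x. P x}"
  using measure_pmf.prob_compl[of "{x. P x}" M]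
  by (simp add: Compl_eq_Diff_UNIV[symmetric] Collect_neg_eq[symmetric])

text \<open>Cutting both events down to the supports makes them countable, as the product rule for
  countable sets requires; the events used here are sets of functions and may be
  uncountable.\<close>

lemma prob_pair_pmf_Times:
  "measure_pmf.prob (pair_pmf M N) (A \<times> B) = measure_pmf.prob M A * measure_pmf.prob N B"
proof -
  have "measure_pmf.prob (pair_pmf M N) (A \<times> B)
      = measure_pmf.prob (pair_pmf M N) ((A \<inter> set_pmf M) \<times> (B \<inter> set_pmf N))"
    by (subst measure_Int_set_pmf[symmetric]) (auto intro: arg_cong2[where f = measure])
  also have "\<dots> = measure_pmf.prob M (A \<inter> set_pmf M) * measure_pmf.prob N (B \<inter> set_pmf N)"
    by (rule measure_pmf_prob_product) (auto intro: countable_subset[OF _ countable_set_pmf])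
  finally show ?thesis by (simp add: measure_Int_set_pmf)
qed

text \<open>The product over \<open>E\<close> arises by gluing independent samples over
  \<open>A\<close> and \<open>E - A\<close>; \<open>P\<close> reads only the first sample and
  \<open>Q\<close> only the second.\<close>

lemma prob_Pi_pmf_indep2:
  assumes E: "finite E" "A \<subseteq> E"
    and P: "\<And>f g. (\<And>x. x \<in> A \<Longrightarrow> f x = g x) \<Longrightarrow> P f = P g"
    and Q: "\<And>f g. (\<And>x. x \<in> E - A \<Longrightarrow> f x = g x) \<Longrightarrow> Q f = Q g"
  shows "measure_pmf.prob (Pi_pmf E d p) {f. P f \<and> Q f} =
         measure_pmf.prob (Pi_pmf E d p) {f. P f} * measure_pmf.prob (Pi_pmf E d p) {f. Q f}"
proof -
  let ?M = "Pi_pmf A d p" and ?N = "Pi_pmf (E - A) d p"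
  let ?h = "\<lambda>(f, g) x. if x \<in> A then f x else g x"
  have split: "Pi_pmf E d p = map_pmf ?h (pair_pmf ?M ?N)"
    using Pi_pmf_union[of A "E - A" d p] E by (auto simp: finite_subset Un_absorb1)
  have hP: "P (?h z) = P (fst z)" for z by (rule P) (auto split: prod.split)
  have hQ: "Q (?h z) = Q (snd z)" for z by (rule Q) (auto split: prod.split)
  \<comment> \<open>Stated for arbitrary predicates because three instances are needed: with
    \<open>Q'\<close> or \<open>P'\<close> trivially true, it identifies the two factors with
    probabilities under the whole product.\<close>
  have "measure_pmf.prob (Pi_pmf E d p) {f. P' f \<and> Q' f}
      = measure_pmf.prob ?M {f. P' f} * measure_pmf.prob ?N {f. Q' f}"
    if "\<And>z. P' (?h z) = P' (fst z)" "\<And>z. Q' (?h z) = Q' (snd z)" for P' Q'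
  proof -
    have "?h -` {f. P' f \<and> Q' f} = {f. P' f} \<times> {f. Q' f}"
      using that by auto
    then show ?thesis
      unfolding split by (simp add: prob_pair_pmf_Times)
  qed note * = this
  from *[of P Q] *[of P "\<lambda>_. True"] *[of "\<lambda>_. True" Q] hP hQ show ?thesis
    by simp
qed

text \<open>Induction over \<open>J\<close>: the blocks of all other indices lie in
  \<open>E - B j\<close>, so the event for \<open>j\<close> splits off by the two-event
  case.\<close>

lemma prob_Pi_pmf_indep:
  assumes E: "finite E" and J: "finite J"
    and B: "\<And>j. j \<in> J \<Longrightarrow> B j \<subseteq> E" "disjoint_family_on B J"
    and P: "\<And>j f g. j \<in> J \<Longrightarrow> (\<And>x. x \<in> B j \<Longrightarrow> f x = g x) \<Longrightarrow> P j f = P j g"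
  shows "measure_pmf.prob (Pi_pmf E d p) {f. \<forall>j\<in>J. P j f} =
         (\<Prod>j\<in>J. measure_pmf.prob (Pi_pmf E d p) {f. P j f})"
  using J B P
proof (induction J rule: finite_induct)
  case (insert j J)
  have disj: "B i \<subseteq> E - B j" if "i \<in> J" for i
    using insert.prems(1)[of i] insert.hyps that
      disjoint_family_onD[OF insert.prems(2), of i j] by auto
  have "measure_pmf.prob (Pi_pmf E d p) {f. P j f \<and> (\<forall>i\<in>J. P i f)} =
     measure_pmf.prob (Pi_pmf E d p) {f. P j f} *
     measure_pmf.prob (Pi_pmf E d p) {f. \<forall>i\<in>J. P i f}"
  proof (rule prob_Pi_pmf_indep2[OF E, of "B j"])
    show "P j f = P j g" if "\<And>x. x \<in> B j \<Longrightarrow> f x = g x" for f g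
      using insert.prems(3)[of j f g] that by simp
    show "(\<forall>i\<in>J. P i f) = (\<forall>i\<in>J. P i g)" if "\<And>x. x \<in> E - B j \<Longrightarrow> f x = g x" for f g
      by (intro ball_cong refl insert.prems(3)) (use disj that in auto)
  qed (use insert.prems(1) in auto)
  also have "measure_pmf.prob (Pi_pmf E d p) {f. \<forall>i\<in>J. P i f} =
     (\<Prod>j\<in>J. measure_pmf.prob (Pi_pmf E d p) {f. P j f})"
  proof (rule insert.IH)
    show "disjoint_family_on B J"
      using insert.prems(2) by (rule disjoint_family_on_mono[rotated]) auto
    show "P i f = P i g" if "i \<in> J" "\<And>x. x \<in> B i \<Longrightarrow> f x = g x" for i f g
      using insert.prems(3)[of i f g] that by simp
  qed (use insert.prems(1) in auto)
  finally show ?case using insert.hyps by simp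
qed simp

lemma prob_Pi_pmf_cylinder:
  assumes "finite E" "finite S" "e ` S \<subseteq> E" "inj_on e S"
  shows "measure_pmf.prob (Pi_pmf E d p) {f. \<forall>s\<in>S. f (e s) = a s} = (\<Prod>s\<in>S. pmf (p (e s)) (a s))"
proof -
  have "measure_pmf.prob (Pi_pmf E d p) {f. \<forall>s\<in>S. f (e s) = a s} =
      (\<Prod>s\<in>S. measure_pmf.prob (Pi_pmf E d p) {f. f (e s) = a s})"
  proof (rule prob_Pi_pmf_indep[where B = "\<lambda>s. {e s}"])
    show "disjoint_family_on (\<lambda>s. {e s}) S"
      using assms(4) by (auto simp: disjoint_family_on_def inj_on_def)
  qed (use assms(1-3) in auto)
  also have "\<dots> = (\<Prod>s\<in>S. pmf (p (e s)) (a s))"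
  proof (rule prod.cong)
    fix s assume "s \<in> S"
    then have "map_pmf (\<lambda>f. f (e s)) (Pi_pmf E d p) = p (e s)"
      using Pi_pmf_component[OF \<open>finite E\<close>, of "e s" d p] assms by auto
    then have "pmf (p (e s)) (a s) = pmf (map_pmf (\<lambda>f. f (e s)) (Pi_pmf E d p)) (a s)"
      by simp
    then show "measure_pmf.prob (Pi_pmf E d p) {f. f (e s) = a s} = pmf (p (e s)) (a s)"
      by (simp add: pmf_map vimage_def)
  qed simp
  finally show ?thesis .
qed

lemma prob_Pi_pmf_no_cylinder:
  assumes "finite E" "finite S" "finite W"
    and e: "\<And>v s. v \<in> W \<Longrightarrow> s \<in> S \<Longrightarrow> e v s \<in> E"
    and inj: "inj_on (\<lambda>(v, s). e v s) (W \<times> S)"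
  shows "measure_pmf.prob (Pi_pmf E d p) {f. \<forall>v\<in>W. \<not> (\<forall>s\<in>S. f (e v s) = a s)} =
    (\<Prod>v\<in>W. 1 - (\<Prod>s\<in>S. pmf (p (e v s)) (a s)))"
proof -
  have "measure_pmf.prob (Pi_pmf E d p) {f. \<forall>v\<in>W. \<not> (\<forall>s\<in>S. f (e v s) = a s)} =
      (\<Prod>v\<in>W. measure_pmf.prob (Pi_pmf E d p) {f. \<not> (\<forall>s\<in>S. f (e v s) = a s)})"
  proof (rule prob_Pi_pmf_indep[where B = "\<lambda>v. e v ` S"])
    show "disjoint_family_on (\<lambda>v. e v ` S) W"
      using inj by (force simp: disjoint_family_on_def inj_on_def)
    show "(\<not> (\<forall>s\<in>S. f (e v s) = a s)) = (\<not> (\<forall>s\<in>S. g (e v s) = a s))"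
      if "\<And>x. x \<in> e v ` S \<Longrightarrow> f x = g x" for v f g
      using that by simp
  qed (use assms in auto)
  also have "\<dots> = (\<Prod>v\<in>W. 1 - (\<Prod>s\<in>S. pmf (p (e v s)) (a s)))"
  proof (rule prod.cong)
    fix v assume v: "v \<in> W"
    have "inj_on (e v) S" using inj v by (auto simp: inj_on_def)
    then have "measure_pmf.prob (Pi_pmf E d p) {f. \<forall>s\<in>S. f (e v s) = a s} =
        (\<Prod>s\<in>S. pmf (p (e v s)) (a s))"
      by (intro prob_Pi_pmf_cylinder) (use assms v in auto)
    moreover have "measure_pmf.prob (Pi_pmf E d p) {f. \<not> (\<forall>s\<in>S. f (e v s) = a s)} =
        1 - measure_pmf.prob (Pi_pmf E d p) {f. \<forall>s\<in>S. f (e v s) = a s}"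
      by (rule prob_not)
    ultimately show "measure_pmf.prob (Pi_pmf E d p) {f. \<not> (\<forall>s\<in>S. f (e v s) = a s)} =
        1 - (\<Prod>s\<in>S. pmf (p (e v s)) (a s))" by simp
  qed simp
  finally show ?thesis .
qed

section \<open>Independent sets without a common neighbour force more than \<open>k\<close>
  colors\<close>

text \<open>With at most \<open>card S\<close> edges, the tree would consist of exactly one edge
  from each \<open>s\<close> in \<open>S\<close> to a vertex \<open>f s\<close> outside
  \<open>S\<close>. Connectedness then makes \<open>f\<close> constant, and its value is a common
  neighbour of \<open>S\<close>.\<close>

lemma tree_card_edges_gt:
  assumes G: "simple_graph G" and T: "subgraph T G" "tree T" "S \<subseteq> verts T"
    and S: "card S \<ge> 2"
    and indep: "\<And>e. e \<in> edges G \<Longrightarrow> \<not> e \<subseteq> S"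
    and no_common: "\<And>v. \<exists>s\<in>S. {s, v} \<notin> edges G"
  shows "card (edges T) > card S"
proof (rule ccontr)
  assume "\<not> ?thesis"
  then have le: "card (edges T) \<le> card S" by simp
  have sT: "simple_graph T" "edges T \<subseteq> edges G" using T by (auto simp: subgraph_def)
  have finT: "finite (edges T)"
    using sT(1) by (intro finite_subset[of "edges T" "Pow (verts T)"]) (auto simp: simple_graph_def)
  let ?R = "{(x, y). {x, y} \<in> edges T}"
  have conn: "(u, v) \<in> ?R\<^sup>*" if "u \<in> S" "v \<in> S" for u v
    using T that by (auto simp: tree_def connected_graph_def)
  have finS: "finite S" using S by (cases "finite S") auto
  have "\<exists>v. {s, v} \<in> edges T" if "s \<in> S" for s
  proof -
    obtain t where "t \<in> S" "t \<noteq> s"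
      using S finS that by (metis One_nat_def card_le_Suc0_iff_eq not_less_eq_eq numeral_2_eq_2)
    then have "(s, t) \<in> ?R\<^sup>*" using conn that by auto
    with \<open>t \<noteq> s\<close> show ?thesis by (auto elim: converse_rtranclE)
  qed
  then obtain f where f: "\<And>s. s \<in> S \<Longrightarrow> {s, f s} \<in> edges T" by metis
  have fS: "f s \<notin> S" if "s \<in> S" for s
    using indep[of "{s, f s}"] f[OF that] that sT by auto
  have inj: "inj_on (\<lambda>s. {s, f s}) S"
    using fS by (auto simp: inj_on_def doubleton_eq_iff)
  \<comment> \<open>These are already \<open>card S\<close> different edges, so no further edge
    fits.\<close>
  have eq: "edges T = (\<lambda>s. {s, f s}) ` S"
    using f le inj finT by (intro card_seteq[symmetric]) (auto simp: card_image)
  obtain r where r: "r \<in> S" using S by fastforce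
  \<comment> \<open>Invariant of a walk from \<open>r\<close>: every edge joins some
    \<open>s\<close> to \<open>f s\<close>, so the walk alternates between \<open>f r\<close> and
    vertices that \<open>f\<close> sends to \<open>f r\<close>.\<close>
  have reach: "y = f r \<or> (y \<in> S \<and> f y = f r)" if "(r, y) \<in> ?R\<^sup>*" for y
    using that
  proof (induction rule: rtrancl_induct)
    case (step y z)
    then obtain s where "s \<in> S" "{y, z} = {s, f s}" using eq by auto
    then show ?case using step.IH fS r by (auto simp: doubleton_eq_iff)
  qed (use r in auto)
  have "f s = f r" if "s \<in> S" for s
    using reach[OF conn[OF r that]] fS[OF r] that by auto
  then have "\<forall>s\<in>S. {s, f r} \<in> edges G" using f sT(2) by fastforce
  then show False using no_common by blast
qed

text \<open>A single rainbow tree on \<open>S\<close> suffices, since it shows as many colors as it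
  has edges. If no suitable coloring exists, the index is infinite and the bound holds as
  well.\<close>

lemma rainbow_index_gt:
  assumes G: "simple_graph G" and S: "S \<subseteq> verts G" "card S = k" "k \<ge> 2" and l: "l \<ge> 1"
    and indep: "\<And>e. e \<in> edges G \<Longrightarrow> \<not> e \<subseteq> S"
    and no_common: "\<And>v. \<exists>s\<in>S. {s, v} \<notin> edges G"
  shows "rainbow_index k l G > enat k"
proof -
  have "enat (Suc k) \<le> enat (card (col ` edges G))" if col: "rainbow_coloring k l G col" for col
  proof -
    obtain T' where "\<forall>i<l. rainbow_S_tree G col S (T' i)"
      using col S unfolding rainbow_coloring_def by blast
    then obtain T where "rainbow_S_tree G col S T" using l by (metis One_nat_def Suc_le_lessD)
    then have T: "subgraph T G" "tree T" "S \<subseteq> verts T" "inj_on col (edges T)"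
      by (auto simp: rainbow_S_tree_def rainbow_tree_def)
    have "k < card (edges T)"
      using tree_card_edges_gt[OF G T(1-3) _ indep no_common] S by simp
    also have "\<dots> = card (col ` edges T)" using T(4) by (simp add: card_image)
    also have "\<dots> \<le> card (col ` edges G)"
    proof (rule card_mono)
      have "finite (edges G)"
        using G by (intro finite_subset[of "edges G" "Pow (verts G)"]) (auto simp: simple_graph_def)
      then show "finite (col ` edges G)" by simp
      show "col ` edges T \<subseteq> col ` edges G" using T(1) by (auto simp: subgraph_def)
    qed
    finally show ?thesis by simp
  qed
  then have "enat (Suc k) \<le> rainbow_index k l G"
    unfolding rainbow_index_def by (intro INF_greatest) auto
  then show ?thesis by (metis Suc_ile_eq)
qed

section \<open>Stars as internally disjoint rainbow trees\<close>

definition star :: "'v set \<Rightarrow> 'v \<Rightarrow> 'v graph" where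
  "star S v = (insert v S, (\<lambda>s. {s, v}) ` S)"

lemma tree_star:
  assumes "finite S" "v \<notin> S"
  shows "tree (star S v)"
proof -
  have edge: "{x, y} \<in> edges (star S v) \<longleftrightarrow> x \<in> S \<and> y = v \<or> y \<in> S \<and> x = v" for x y
    by (auto simp: star_def doubleton_eq_iff)
  have "simple_graph (star S v)"
    using assms by (auto simp: simple_graph_def star_def card_insert_if)
  moreover have "connected_graph (star S v)"
    unfolding connected_graph_def
  proof (intro conjI ballI)
    let ?R = "{(x, y). {x, y} \<in> edges (star S v)}"
    fix x y assume xy: "x \<in> verts (star S v)" "y \<in> verts (star S v)"
    have "(x, v) \<in> ?R\<^sup>*" using xy(1) edge by (cases "x = v") (auto simp: star_def)
    moreover have "(v, y) \<in> ?R\<^sup>*" using xy(2) edge by (cases "y = v") (auto simp: star_def)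
    ultimately show "(x, y) \<in> ?R\<^sup>*" by (rule rtrancl_trans)
  qed (auto simp: star_def)
  \<comment> \<open>Every edge contains \<open>v\<close>. The first two edges of a cycle force
    \<open>xs ! 1 = v\<close>, since otherwise \<open>xs ! 0\<close> and \<open>xs ! 2\<close> would
    both be \<open>v\<close>; the third edge then avoids \<open>v\<close>.\<close>
  moreover have "\<not> cycle (star S v) xs" for xs
  proof
    assume c: "cycle (star S v) xs"
    then have len: "length xs \<ge> 3" "xs \<noteq> []" and d: "distinct xs"
      and e: "\<And>i. i < length xs \<Longrightarrow> {xs ! i, xs ! (Suc i mod length xs)} \<in> edges (star S v)"
      by (auto simp: cycle_def)
    have 01: "xs ! 0 = v \<or> xs ! 1 = v" using e[of 0] len unfolding edge by (auto simp: mod_Suc)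
    have 12: "xs ! 1 = v \<or> xs ! 2 = v"
      using e[of 1] len unfolding edge by (auto simp: mod_Suc numeral_2_eq_2)
    have "xs ! 0 \<noteq> xs ! 1" "xs ! 0 \<noteq> xs ! 2" "xs ! 1 \<noteq> xs ! 2"
      using d len by (auto simp: nth_eq_iff_index_eq)
    with 01 12 have 1: "xs ! 1 = v" by auto
    \<comment> \<open>The successor of position 2 wraps around to 0 exactly when the cycle is a
      triangle.\<close>
    define i where "i = Suc 2 mod length xs"
    have i: "i < length xs" "i = 0 \<or> i = 3" using len by (cases "length xs = 3"; simp add: i_def)+
    have "xs ! 2 = v \<or> xs ! i = v" using e[of 2] len unfolding edge by (auto simp: i_def)
    with 1 have "xs ! 2 = xs ! 1 \<or> xs ! i = xs ! 1" by auto
    with d len i show False by (auto simp: nth_eq_iff_index_eq)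
  qed
  ultimately show ?thesis by (auto simp: tree_def)
qed

lemma internally_disjoint_stars:
  assumes "inj_on v {..<l}" "\<And>i. i < l \<Longrightarrow> v i \<notin> S"
  shows "internally_disjoint S l (\<lambda>i. star S (v i))"
  unfolding internally_disjoint_def
proof (intro allI impI conjI)
  fix i j assume ij: "i < l" "j < l" "i \<noteq> j"
  then have "v i \<noteq> v j" using assms(1) by (auto simp: inj_on_def)
  then show "edges (star S (v i)) \<inter> edges (star S (v j)) = {}"
      "verts (star S (v i)) \<inter> verts (star S (v j)) = S"
    using assms(2) ij by (auto simp: star_def doubleton_eq_iff)
qed

lemma rainbow_index_le:
  assumes G: "simple_graph G" and col: "col ` edges G \<subseteq> {..<k}"
    and stars: "\<And>S. S \<subseteq> verts G \<Longrightarrow> card S = k \<Longrightarrow> \<exists>v. inj_on v {..<l} \<and>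
      (\<forall>i<l. v i \<in> verts G - S \<and> (\<forall>s\<in>S. {s, v i} \<in> edges G) \<and> inj_on (\<lambda>s. col {s, v i}) S)"
  shows "rainbow_index k l G \<le> enat k"
proof -
  have "rainbow_coloring k l G col"
    unfolding rainbow_coloring_def
  proof (intro allI impI)
    fix S assume S: "S \<subseteq> verts G \<and> card S = k"
    then obtain v where v: "inj_on v {..<l}" "\<And>i. i < l \<Longrightarrow> v i \<in> verts G - S"
        "\<And>i s. i < l \<Longrightarrow> s \<in> S \<Longrightarrow> {s, v i} \<in> edges G"
        "\<And>i. i < l \<Longrightarrow> inj_on (\<lambda>s. col {s, v i}) S"
      using stars[of S] by auto
    have finS: "finite S" using S G by (auto simp: simple_graph_def intro: finite_subset)
    have "rainbow_S_tree G col S (star S (v i))" if i: "i < l" for i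
    proof -
      have T: "tree (star S (v i))" by (rule tree_star) (use finS v(2)[OF i] in auto)
      then have "subgraph (star S (v i)) G"
        using v(2,3)[OF i] S by (auto simp: subgraph_def tree_def star_def)
      moreover have "inj_on col (edges (star S (v i)))"
        using v(4)[OF i] by (auto simp: star_def inj_on_def)
      ultimately show ?thesis
        using T by (auto simp: rainbow_S_tree_def rainbow_tree_def star_def)
    qed
    moreover have "internally_disjoint S l (\<lambda>i. star S (v i))"
      by (rule internally_disjoint_stars) (use v in auto)
    ultimately show "\<exists>T. (\<forall>i<l. rainbow_S_tree G col S (T i)) \<and> internally_disjoint S l T"
      by (intro exI[of _ "\<lambda>i. star S (v i)"]) auto
  qed
  then have "rainbow_index k l G \<le> enat (card (col ` edges G))"
    unfolding rainbow_index_def by (intro INF_lower) auto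
  also have "card (col ` edges G) \<le> card {..<k}"
    by (rule card_mono[OF _ col]) simp
  finally show ?thesis by simp
qed

section \<open>The random graph as an image of a product distribution, and equal partitions\<close>

definition pairs :: "nat \<Rightarrow> nat set set" where
  "pairs n = {e. e \<subseteq> {..<n} \<and> card e = 2}"

definition graph_of :: "nat \<Rightarrow> (nat set \<Rightarrow> bool) \<Rightarrow> nat graph" where
  "graph_of n f = ({..<n}, {e \<in> pairs n. f e})"

lemma finite_pairs [simp]: "finite (pairs n)"
  by (rule finite_subset[of _ "Pow {..<n}"]) (auto simp: pairs_def)

lemma doubleton_in_pairs: "s < n \<Longrightarrow> v < n \<Longrightarrow> s \<noteq> v \<Longrightarrow> {s, v} \<in> pairs n"
  by (auto simp: pairs_def)

lemma simple_graph_of: "simple_graph (graph_of n f)"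
  by (auto simp: simple_graph_def graph_of_def pairs_def)

lemma random_graph_conv:
  "random_graph n p = map_pmf (graph_of n) (Pi_pmf (pairs n) False (\<lambda>_. bernoulli_pmf p))"
  by (simp add: random_graph_def graph_of_def[abs_def] pairs_def Let_def)

lemma choose_le_pow: "n choose k \<le> n ^ k"
  by (cases "k \<le> n") (auto simp: binomial_le_pow not_le binomial_eq_0)

text \<open>Enumerate \<open>A\<close> and cut the enumeration into consecutive intervals of length
  \<open>w\<close>; they are disjoint because \<open>x div w\<close> recovers the index of the
  interval. This yields both the classes of possible centers and the disjoint
  \<open>k\<close>-sets.\<close>

lemma exists_equal_parts:
  assumes "finite A" "l * w \<le> card A"
  shows "\<exists>W. (\<forall>i<l. W i \<subseteq> A \<and> card (W i) = w) \<and> disjoint_family_on W {..<l}"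
proof -
  obtain h where h: "bij_betw h {0..<card A} A"
    using ex_bij_betw_nat_finite[OF assms(1)] by blast
  have sub: "{i * w..<i * w + w} \<subseteq> {0..<card A}" if "i < l" for i
  proof -
    have "i * w + w \<le> l * w" using that by (metis Suc_leI add.commute mult_Suc mult_le_mono1)
    then show ?thesis using assms(2) by auto
  qed
  have inj: "inj_on h {0..<card A}" using h by (rule bij_betw_imp_inj_on)
  have "h ` {i * w..<i * w + w} \<inter> h ` {j * w..<j * w + w} = {}" if "i < l" "j < l" "i \<noteq> j" for i j
  proof -
    have "{i * w..<i * w + w} \<inter> {j * w..<j * w + w} = {}"
    proof (rule ccontr)
      assume "\<not> ?thesis"
      then obtain x where "x \<in> {i * w..<i * w + w}" "x \<in> {j * w..<j * w + w}" by blast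
      then have "x div w = i" "x div w = j"
        by (auto intro!: div_nat_eqI simp: algebra_simps)
      with that show False by simp
    qed
    then show ?thesis
      using inj_on_image_Int[OF inj sub[OF that(1)] sub[OF that(2)]] by (metis image_empty)
  qed
  then have "disjoint_family_on (\<lambda>i. h ` {i * w..<i * w + w}) {..<l}"
    by (auto simp: disjoint_family_on_def)
  moreover have "h ` {i * w..<i * w + w} \<subseteq> A" "card (h ` {i * w..<i * w + w}) = w" if "i < l" for i
    using sub[OF that] h inj_on_subset[OF inj sub[OF that]]
    by (auto simp: card_image bij_betw_def)
  ultimately show ?thesis by (intro exI[of _ "\<lambda>i. h ` {i * w..<i * w + w}"]) auto
qed

section \<open>Above the threshold: random colorings\<close>

text \<open>Absent pairs are colored too. Presence and color thus form one coordinate of a single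
  product, and a star with prescribed colors is a cylinder event.\<close>

definition colored_pmf :: "nat \<Rightarrow> nat \<Rightarrow> real \<Rightarrow> (nat set \<Rightarrow> bool \<times> nat) pmf" where
  "colored_pmf k n p =
     Pi_pmf (pairs n) (False, 0) (\<lambda>_. pair_pmf (bernoulli_pmf p) (pmf_of_set {..<k}))"

lemma random_graph_conv_colored:
  assumes "k \<ge> 1"
  shows "random_graph n p = map_pmf (\<lambda>f. graph_of n (fst \<circ> f)) (colored_pmf k n p)"
proof -
  have "Pi_pmf (pairs n) False (\<lambda>_. bernoulli_pmf p) = map_pmf (\<lambda>f. fst \<circ> f) (colored_pmf k n p)"
    unfolding colored_pmf_def
    using Pi_pmf_map[of "pairs n" fst "(False, 0 :: nat)" False
        "\<lambda>_. pair_pmf (bernoulli_pmf p) (pmf_of_set {..<k})"]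
    by (simp add: map_fst_pair_pmf)
  then show ?thesis by (simp add: random_graph_conv map_pmf_comp)
qed

text \<open>Reduction mod \<open>k\<close> bounds the colors for every \<open>f\<close>, even
  outside the support of \<open>colored_pmf\<close>, and does not change colors below
  \<open>k\<close>.\<close>

definition rainbow_stars :: "nat \<Rightarrow> nat \<Rightarrow> nat \<Rightarrow> nat set \<Rightarrow> (nat set \<Rightarrow> bool \<times> nat) \<Rightarrow> bool" where
  "rainbow_stars k l n S f \<longleftrightarrow> (\<exists>v. inj_on v {..<l} \<and>
     (\<forall>i<l. v i \<in> {..<n} - S \<and> (\<forall>s\<in>S. fst (f {s, v i})) \<and>
       inj_on (\<lambda>s. snd (f {s, v i}) mod k) S))"

lemma rainbow_index_le_if_rainbow_stars:
  assumes "k \<ge> 1" "\<And>S. S \<subseteq> {..<n} \<Longrightarrow> card S = k \<Longrightarrow> rainbow_stars k l n S f"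
  shows "rainbow_index k l (graph_of n (fst \<circ> f)) \<le> enat k"
proof (rule rainbow_index_le[where col = "\<lambda>e. snd (f e) mod k"])
  fix S assume S: "S \<subseteq> verts (graph_of n (fst \<circ> f))" "card S = k"
  then obtain v where v: "inj_on v {..<l}" "\<forall>i<l. v i \<in> {..<n} - S \<and> (\<forall>s\<in>S. fst (f {s, v i})) \<and>
       inj_on (\<lambda>s. snd (f {s, v i}) mod k) S"
    using assms(2)[of S] by (auto simp: graph_of_def rainbow_stars_def)
  have "{s, v i} \<in> pairs n" if "i < l" "s \<in> S" for i s
    using v(2) that S(1) by (intro doubleton_in_pairs) (auto simp: graph_of_def)
  with v show "\<exists>v. inj_on v {..<l} \<and>
      (\<forall>i<l. v i \<in> verts (graph_of n (fst \<circ> f)) - S \<and>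
        (\<forall>s\<in>S. {s, v i} \<in> edges (graph_of n (fst \<circ> f))) \<and>
        inj_on (\<lambda>s. snd (f {s, v i}) mod k) S)"
    by (intro exI[of _ v]) (auto simp: graph_of_def)
qed (use assms(1) simple_graph_of in \<open>auto simp: image_subset_iff\<close>)

text \<open>
  Prescribing the color of every edge of the star by a fixed bijection only costs a constant
  factor in the exponent compared with the probability that the star is rainbow.
\<close>

lemma prob_no_rainbow_stars:
  assumes k: "k \<ge> 1" and p: "0 \<le> p" "p \<le> 1" and S: "S \<subseteq> {..<n}" "card S = k"
  shows "measure_pmf.prob (colored_pmf k n p) {f. \<not> rainbow_stars k l n S f}
    \<le> real l * (1 - (p / real k) ^ k) ^ ((n - k) div l)"
proof -
  define w where "w = (n - k) div l"
  have finS: "finite S" using S(1) by (rule finite_subset) simp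
  have "card ({..<n} - S) = n - k" using S finS by (simp add: card_Diff_subset)
  then have "finite ({..<n} - S)" "l * w \<le> card ({..<n} - S)" by (simp_all add: w_def)
  then obtain W where W: "\<And>i. i < l \<Longrightarrow> W i \<subseteq> {..<n} - S" "\<And>i. i < l \<Longrightarrow> card (W i) = w"
      "disjoint_family_on W {..<l}"
    using exists_equal_parts[of "{..<n} - S" l w] by blast
  obtain b where b: "bij_betw b S {0..<k}"
    using ex_bij_betw_finite_nat[OF finS] S(2) by auto
  have bk: "b s < k" if "s \<in> S" for s using bij_betwE[OF b] that by auto
  \<comment> \<open>No vertex of the part \<open>W i\<close> is joined to all of \<open>S\<close>
    with exactly the colors given by \<open>b\<close>.\<close>
  let ?bad = "\<lambda>i. {f. \<forall>v\<in>W i. \<not> (\<forall>s\<in>S. f {s, v} = (True, b s))}"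
  have "measure_pmf.prob (colored_pmf k n p) (?bad i) = (1 - (p / real k) ^ k) ^ w" if i: "i < l" for i
  proof -
    have "measure_pmf.prob (colored_pmf k n p) (?bad i) = (\<Prod>v\<in>W i. 1 - (\<Prod>s\<in>S.
        pmf (pair_pmf (bernoulli_pmf p) (pmf_of_set {..<k})) (True, b s)))"
      unfolding colored_pmf_def
    proof (rule prob_Pi_pmf_no_cylinder)
      show "finite (W i)" using W(1)[OF i] by (rule finite_subset) simp
      show "{s, v} \<in> pairs n" if "v \<in> W i" "s \<in> S" for v s
        using W(1)[OF i] S(1) that by (intro doubleton_in_pairs) auto
      show "inj_on (\<lambda>(v, s). {s, v}) (W i \<times> S)"
        using W(1)[OF i] by (auto simp: inj_on_def doubleton_eq_iff)
    qed (use finS in auto)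
    also have "(\<Prod>s\<in>S. pmf (pair_pmf (bernoulli_pmf p) (pmf_of_set {..<k})) (True, b s)) =
        (\<Prod>s\<in>S. p / real k)"
      using k p bk by (intro prod.cong) (auto simp: pmf_pair pmf_of_set lessThan_empty_iff)
    finally show ?thesis using S(2) W(2)[OF i] by simp
  qed
  then have "measure_pmf.prob (colored_pmf k n p) (\<Union>i\<in>{..<l}. ?bad i)
      \<le> real (card {..<l}) * (1 - (p / real k) ^ k) ^ w"
    by (intro prob_UN_le) auto
  moreover
  \<comment> \<open>If no part is bad, picking a center from each part gives \<open>l\<close>
    different centers, as the parts are disjoint.\<close>
  have "{f. \<not> rainbow_stars k l n S f} \<subseteq> (\<Union>i\<in>{..<l}. ?bad i)"
  proof (rule subsetI, rule ccontr)
    fix f assume f: "f \<in> {f. \<not> rainbow_stars k l n S f}" "f \<notin> (\<Union>i\<in>{..<l}. ?bad i)"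
    then have "\<forall>i\<in>{..<l}. \<exists>v\<in>W i. \<forall>s\<in>S. f {s, v} = (True, b s)" by auto
    then obtain v where v: "\<And>i. i < l \<Longrightarrow> v i \<in> W i"
        "\<And>i s. i < l \<Longrightarrow> s \<in> S \<Longrightarrow> f {s, v i} = (True, b s)"
      by (metis lessThan_iff)
    have "inj_on v {..<l}"
      using v(1) disjoint_family_onD[OF W(3)] by (intro inj_onI) (metis disjoint_iff lessThan_iff)
    moreover have "inj_on (\<lambda>s. snd (f {s, v i}) mod k) S" if "i < l" for i
      using b v(2)[OF that] bk by (auto simp: inj_on_def bij_betw_def)
    ultimately have "rainbow_stars k l n S f"
      unfolding rainbow_stars_def using v W(1) by (intro exI[of _ v]) fastforce
    with f show False by simp
  qed
  then have "measure_pmf.prob (colored_pmf k n p) {f. \<not> rainbow_stars k l n S f}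
      \<le> measure_pmf.prob (colored_pmf k n p) (\<Union>i\<in>{..<l}. ?bad i)"
    by (rule measure_pmf.finite_measure_mono) simp
  ultimately show ?thesis by (simp add: w_def)
qed

text \<open>Union bound over the at most \<open>n ^ k\<close> sets \<open>S\<close>.\<close>

lemma prob_rainbow_index_not_le:
  assumes k: "k \<ge> 1" and p: "0 \<le> p" "p \<le> 1"
  shows "measure_pmf.prob (random_graph n p) {G. \<not> rainbow_index k l G \<le> enat k}
    \<le> real n ^ k * (real l * (1 - (p / real k) ^ k) ^ ((n - k) div l))"
proof -
  let ?I = "{S. S \<subseteq> {..<n} \<and> card S = k}"
  let ?b = "real l * (1 - (p / real k) ^ k) ^ ((n - k) div l)"
  have fin: "finite ?I" by (rule finite_subset[of _ "Pow {..<n}"]) auto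
  have "p / real k \<le> 1" using k p by (simp add: field_simps)
  then have "(p / real k) ^ k \<le> 1" using p by (intro power_le_one) auto
  then have b: "?b \<ge> 0" by simp
  \<comment> \<open>The index depends on the graph alone, so the colors can be drawn along with it;
    they serve only as the witness coloring.\<close>
  have "measure_pmf.prob (random_graph n p) {G. \<not> rainbow_index k l G \<le> enat k} =
    measure_pmf.prob (colored_pmf k n p) {f. \<not> rainbow_index k l (graph_of n (fst \<circ> f)) \<le> enat k}"
    unfolding random_graph_conv_colored[OF k] by (simp add: vimage_def)
  also have "\<dots> \<le> measure_pmf.prob (colored_pmf k n p) (\<Union>S\<in>?I. {f. \<not> rainbow_stars k l n S f})"
  proof (rule measure_pmf.finite_measure_mono)
    show "{f. \<not> rainbow_index k l (graph_of n (fst \<circ> f)) \<le> enat k}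
        \<subseteq> (\<Union>S\<in>?I. {f. \<not> rainbow_stars k l n S f})"
      using rainbow_index_le_if_rainbow_stars[OF k, of n l] by blast
  qed simp
  also have "\<dots> \<le> real (card ?I) * ?b"
    by (rule prob_UN_le[OF fin]) (use prob_no_rainbow_stars[OF k p] in auto)
  also have "\<dots> \<le> real n ^ k * ?b"
  proof (rule mult_right_mono[OF _ b])
    have "card ?I = n choose k" using n_subsets[of "{..<n}" k] by simp
    then show "real (card ?I) \<le> real n ^ k"
      using choose_le_pow[of n k] by (metis of_nat_le_iff of_nat_power)
  qed
  finally show ?thesis .
qed

section \<open>Below the threshold: disjoint \<open>k\<close>-sets and their common
  neighbours\<close>

lemma prob_edge_inside_le:
  assumes p: "0 \<le> p" "p \<le> 1" and mn: "m \<le> n"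
  shows "measure_pmf.prob (Pi_pmf (pairs n) False (\<lambda>_. bernoulli_pmf p)) {f. \<exists>e\<in>pairs m. f e}
    \<le> real m ^ 2 * p"
proof -
  let ?M = "Pi_pmf (pairs n) False (\<lambda>_. bernoulli_pmf p)"
  have "measure_pmf.prob ?M {f. f e} = p" if "e \<in> pairs m" for e
    using prob_Pi_pmf_cylinder[of "pairs n" "{e}" id False "\<lambda>_. bernoulli_pmf p" "\<lambda>_. True"]
      that mn p by (force simp: pairs_def)
  then have "measure_pmf.prob ?M (\<Union>e\<in>pairs m. {f. f e}) \<le> real (card (pairs m)) * p"
    by (intro prob_UN_le) auto
  also have "\<dots> \<le> real m ^ 2 * p"
  proof (rule mult_right_mono[OF _ p(1)])
    have "card (pairs m) = m choose 2" using n_subsets[of "{..<m}" 2] by (simp add: pairs_def)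
    then show "real (card (pairs m)) \<le> real m ^ 2"
      using choose_le_pow[of m 2] by (metis of_nat_le_iff of_nat_power)
  qed
  also have "(\<Union>e\<in>pairs m. {f. f e}) = {f. \<exists>e\<in>pairs m. f e}" by auto
  finally show ?thesis .
qed

text \<open>The sets \<open>S i\<close> are disjoint from each other and from \<open>W\<close>, so
  the edges between \<open>S i\<close> and \<open>W\<close> form disjoint blocks for different
  \<open>i\<close> and the events are independent.\<close>

lemma prob_all_have_common_neighbour:
  assumes p: "0 \<le> p" "p \<le> 1" and S: "disjoint_family_on S {..<m}"
    "\<And>i. i < m \<Longrightarrow> S i \<subseteq> {..<n} - W" "\<And>i. i < m \<Longrightarrow> card (S i) = k"
    and W: "W \<subseteq> {..<n}"
  shows "measure_pmf.prob (Pi_pmf (pairs n) False (\<lambda>_. bernoulli_pmf p))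
      {f. \<forall>i<m. \<exists>v\<in>W. \<forall>s\<in>S i. f {s, v}} = (1 - (1 - p ^ k) ^ card W) ^ m"
proof -
  let ?M = "Pi_pmf (pairs n) False (\<lambda>_. bernoulli_pmf p)"
  have fin: "finite W" "\<And>i. i < m \<Longrightarrow> finite (S i)"
    using W S(2) by (auto intro: finite_subset)
  have inP: "{s, v} \<in> pairs n" if "i < m" "s \<in> S i" "v \<in> W" for i s v
    using S(2)[of i] W that by (intro doubleton_in_pairs) auto
  have "measure_pmf.prob ?M {f. \<forall>i\<in>{..<m}. \<exists>v\<in>W. \<forall>s\<in>S i. f {s, v}} =
      (\<Prod>i<m. measure_pmf.prob ?M {f. \<exists>v\<in>W. \<forall>s\<in>S i. f {s, v}})"
  proof (rule prob_Pi_pmf_indep[where B = "\<lambda>i. (\<lambda>(s, v). {s, v}) ` (S i \<times> W)"])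
    show "disjoint_family_on (\<lambda>i. (\<lambda>(s, v). {s, v}) ` (S i \<times> W)) {..<m}"
      unfolding disjoint_family_on_def
    proof (intro ballI impI)
      fix i j assume ij: "i \<in> {..<m}" "j \<in> {..<m}" "i \<noteq> j"
      then have "S i \<inter> S j = {}" using S(1) by (auto simp: disjoint_family_on_def)
      moreover have "S i \<inter> W = {}" "S j \<inter> W = {}" using S(2) ij by auto
      ultimately show "(\<lambda>(s, v). {s, v}) ` (S i \<times> W) \<inter> (\<lambda>(s, v). {s, v}) ` (S j \<times> W) = {}"
        by (auto simp: doubleton_eq_iff)
    qed
    show "(\<exists>v\<in>W. \<forall>s\<in>S i. f {s, v}) = (\<exists>v\<in>W. \<forall>s\<in>S i. g {s, v})"
      if "\<And>x. x \<in> (\<lambda>(s, v). {s, v}) ` (S i \<times> W) \<Longrightarrow> f x = g x" for i and f g :: "nat set \<Rightarrow> bool"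
      by (intro bex_cong ball_cong refl that) auto
  qed (use inP in auto)
  also have "\<dots> = (\<Prod>i<m. 1 - (1 - p ^ k) ^ card W)"
  proof (rule prod.cong)
    fix i assume "i \<in> {..<m}"
    then have i: "i < m" by simp
    have "measure_pmf.prob ?M {f. \<forall>v\<in>W. \<not> (\<forall>s\<in>S i. f {s, v} = True)} =
        (\<Prod>v\<in>W. 1 - (\<Prod>s\<in>S i. pmf (bernoulli_pmf p) True))"
      by (rule prob_Pi_pmf_no_cylinder)
        (use i inP fin S(2)[OF i] in \<open>auto simp: inj_on_def doubleton_eq_iff\<close>)
    also have "\<dots> = (1 - p ^ k) ^ card W" using p S(3)[OF i] by simp
    finally show "measure_pmf.prob ?M {f. \<exists>v\<in>W. \<forall>s\<in>S i. f {s, v}} = 1 - (1 - p ^ k) ^ card W"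
      using prob_not[of ?M "\<lambda>f. \<forall>v\<in>W. \<not> (\<forall>s\<in>S i. f {s, v} = True)"] by simp
  qed simp
  finally show ?thesis by (simp only: Ball_def lessThan_iff prod_constant card_lessThan)
qed

text \<open>The \<open>m\<close> sets fill the first \<open>m * k\<close> vertices. The summands
  bound the two ways to fail: an edge among these vertices, or a common neighbour beyond them for
  every set.\<close>

lemma prob_rainbow_index_not_gt:
  assumes k: "k \<ge> 2" and l: "l \<ge> 1" and p: "0 \<le> p" "p \<le> 1" and mn: "m * k \<le> n"
  shows "measure_pmf.prob (random_graph n p) {G. \<not> rainbow_index k l G > enat k}
    \<le> real (m * k) ^ 2 * p + (1 - (1 - p ^ k) ^ (n - m * k)) ^ m"
proof -
  let ?M = "Pi_pmf (pairs n) False (\<lambda>_. bernoulli_pmf p)"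
  obtain S where S: "\<And>i. i < m \<Longrightarrow> S i \<subseteq> {..<m * k}" "\<And>i. i < m \<Longrightarrow> card (S i) = k"
      "disjoint_family_on S {..<m}"
    using exists_equal_parts[of "{..<m * k}" m k] by (metis card_lessThan finite_lessThan le_refl)
  let ?W = "{m * k..<n}"
  let ?A = "{f :: nat set \<Rightarrow> bool. \<exists>e\<in>pairs (m * k). f e}"
  let ?B = "{f :: nat set \<Rightarrow> bool. \<forall>i<m. \<exists>v\<in>?W. \<forall>s\<in>S i. f {s, v}}"
  have "rainbow_index k l (graph_of n f) > enat k" if f: "f \<notin> ?A" "f \<notin> ?B" for f
  proof -
    obtain i where i: "i < m" "\<And>v. v \<in> ?W \<Longrightarrow> \<exists>s\<in>S i. \<not> f {s, v}" using f(2) by auto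
    have no_edge: "\<not> f {s, v}" if "{s, v} \<in> pairs n" "s < m * k" "v < m * k" for s v
      using f(1) that by (auto simp: pairs_def)
    show ?thesis
    proof (rule rainbow_index_gt[OF simple_graph_of _ S(2)[OF i(1)] k l])
      show "S i \<subseteq> verts (graph_of n f)" using S(1)[OF i(1)] mn by (force simp: graph_of_def)
      show "\<not> e \<subseteq> S i" if "e \<in> edges (graph_of n f)" for e
        using that f(1) S(1)[OF i(1)] by (auto simp: graph_of_def pairs_def)
      show "\<exists>s\<in>S i. {s, v} \<notin> edges (graph_of n f)" for v
      \<comment> \<open>Among the first \<open>m * k\<close> vertices there are no edges at all; the
        later ones are excluded by the choice of \<open>i\<close>, and numbers from \<open>n\<close>
        on are not vertices.\<close>
      proof (cases "v < m * k")
        case True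
        obtain s where "s \<in> S i" using S(2)[OF i(1)] k by fastforce
        then show ?thesis using no_edge[of s v] True S(1)[OF i(1)] by (auto simp: graph_of_def)
      next
        case False
        obtain s where s: "s \<in> S i" using S(2)[OF i(1)] k by fastforce
        show ?thesis
        proof (cases "v < n")
          case True
          then show ?thesis using i(2)[of v] False by (auto simp: graph_of_def)
        next
          case False
          then show ?thesis using s by (auto simp: graph_of_def pairs_def)
        qed
      qed
    qed
  qed
  then have "{f. \<not> rainbow_index k l (graph_of n f) > enat k} \<subseteq> ?A \<union> ?B" by blast
  then have "measure_pmf.prob ?M {f. \<not> rainbow_index k l (graph_of n f) > enat k}
      \<le> measure_pmf.prob ?M (?A \<union> ?B)"
    by (intro measure_pmf.finite_measure_mono) auto
  also have "\<dots> \<le> measure_pmf.prob ?M ?A + measure_pmf.prob ?M ?B"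
    by (rule measure_Un_le) auto
  also have "measure_pmf.prob ?M ?A \<le> real (m * k) ^ 2 * p"
    by (rule prob_edge_inside_le[OF p mn])
  also have "measure_pmf.prob ?M ?B = (1 - (1 - p ^ k) ^ (n - m * k)) ^ m"
    using prob_all_have_common_neighbour[OF p S(3), of n ?W k] S mn by fastforce
  finally show ?thesis unfolding random_graph_conv by (simp add: vimage_def)
qed

section \<open>Asymptotic estimates and the choice of constants\<close>

lemma almost_surely_if_prob_not_le:
  assumes "eventually (\<lambda>n. measure_pmf.prob (X n) {x. \<not> P x} \<le> b n) sequentially"
    and "b \<longlonglongrightarrow> 0"
  shows "almost_surely X P"
proof -
  have "(\<lambda>n. measure_pmf.prob (X n) {x. \<not> P x}) \<longlonglongrightarrow> 0"
    by (rule tendsto_sandwich[OF _ assms(1) tendsto_const assms(2)]) simp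
  then have "(\<lambda>n. 1 - measure_pmf.prob (X n) {x. \<not> P x}) \<longlonglongrightarrow> 1 - 0"
    by (intro tendsto_diff tendsto_const)
  then show ?thesis by (simp add: almost_surely_def prob_not)
qed

lemma threshold_base_gt_1:
  assumes "k \<ge> 2"
  shows "threshold_base k > 1"
proof -
  have "fact k < (k ^ k :: nat)"
    using assms
  proof (induction k rule: dec_induct)
    case (step n)
    have "fact (Suc n) = Suc n * (fact n :: nat)" by simp
    also have "\<dots> < Suc n * n ^ n" using step.IH by (rule mult_strict_left_mono) simp
    also have "\<dots> \<le> Suc n * Suc n ^ n" by (intro mult_left_mono power_mono) auto
    finally show ?case by simp
  qed (simp add: numeral_2_eq_2)
  then have "real (fact k) < real (k ^ k)" by (simp only: of_nat_less_iff)
  then have "fact k < real (k ^ k)" by simp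
  moreover have "(fact k :: real) > 0" by simp
  ultimately show ?thesis by (simp add: threshold_base_def field_simps)
qed

text \<open>The factor \<open>ln (threshold_base k)\<close> undoes the change of base in the
  logarithm. Constants of this form turn the \<open>k\<close>-th power of the edge probability into
  a multiple of \<open>ln n / n\<close>.\<close>

lemma mult_threshold:
  assumes k: "k \<ge> 2" and n: "n \<ge> 1" and x: "x \<ge> 0"
  shows "root k (x * ln (threshold_base k)) * threshold k n = root k (x * ln n / n)"
proof -
  have "ln (threshold_base k) > 0" using threshold_base_gt_1[OF k] by simp
  then show ?thesis
    by (simp add: threshold_def log_def real_root_mult[symmetric])
qed

lemma one_minus_power_le_exp:
  fixes x :: real
  assumes "x \<le> 1"
  shows "(1 - x) ^ n \<le> exp (- (x * n))"
proof -
  have "(1 - x) ^ n \<le> exp (- x) ^ n"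
    using assms exp_ge_add_one_self[of "- x"] by (intro power_mono) auto
  then show ?thesis by (simp add: exp_of_nat2_mult mult.commute flip: exp_of_nat_mult)
qed

text \<open>From \<open>ln (1 - x) >= - x - 2 * x ^ 2\<close>, where \<open>x <= 1 / 2\<close>
  absorbs the quadratic term into \<open>- 2 * x\<close>.\<close>

lemma exp_le_one_minus_power:
  fixes x :: real
  assumes "0 \<le> x" "x \<le> 1 / 2"
  shows "exp (- (2 * x * n)) \<le> (1 - x) ^ n"
proof -
  have "x ^ 2 \<le> x * (1 / 2)"
    unfolding power2_eq_square using assms by (intro mult_left_mono) auto
  then have "- (2 * x) \<le> ln (1 - x)"
    using ln_one_minus_pos_lower_bound[OF assms] by simp
  then have "exp (- (2 * x)) \<le> 1 - x"
    using assms by (simp add: ln_ge_iff)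
  then have "exp (- (2 * x)) ^ n \<le> (1 - x) ^ n"
    by (intro power_mono) auto
  then show ?thesis by (simp add: mult.commute flip: exp_of_nat_mult)
qed

theorem theorem3p1:
  fixes k l :: nat
  assumes "k \<ge> 3" and "l \<ge> 1"
  shows "\<exists>c>0. \<exists>C>0.
    (\<forall>p' :: nat \<Rightarrow> real.
       (\<forall>n. 0 \<le> p' n \<and> p' n \<le> 1) \<and>
       (\<forall>\<^sub>F n in sequentially. p' n \<le> c * threshold k n) \<longrightarrow>
       almost_surely (\<lambda>n. random_graph n (p' n)) (\<lambda>G. rainbow_index k l G > enat k)) \<and>
    (\<forall>p'' :: nat \<Rightarrow> real.
       (\<forall>n. 0 \<le> p'' n \<and> p'' n \<le> 1) \<and>
       (\<forall>\<^sub>F n in sequentially. p'' n \<ge> C * threshold k n) \<longrightarrow>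
       almost_surely (\<lambda>n. random_graph n (p'' n)) (\<lambda>G. rainbow_index k l G \<le> enat k))"
proof -
  have k: "k \<ge> 1" "k \<ge> 2" and k0: "k > 0" using assms by auto
  have L: "ln (threshold_base k) > 0" using threshold_base_gt_1[OF k(2)] by simp
  \<comment> \<open>About \<open>n powr e\<close> disjoint \<open>k\<close>-sets are used: few
    enough that their union spans no edge, since the edge probability is about
    \<open>n powr (- 4 * e)\<close> up to logarithms.\<close>
  define e where "e = 1 / (4 * real k)"
  have e: "e > 0" using k by (simp add: e_def)
  \<comment> \<open>Small enough that a given \<open>k\<close>-set lacks a common neighbour outside
    the union with probability at least \<open>n powr (- (e / 2))\<close>, which outweighs one over
    the number of sets.\<close>
  define c where "c = root k (e / 4 * ln (threshold_base k))"
  \<comment> \<open>The factor \<open>real k ^ k\<close> pays for the prescribed colors and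
    \<open>2 * real l\<close> for the size of a part; \<open>real k + 1\<close> leaves a factor
    \<open>1 / n\<close> after the union bound over \<open>n ^ k\<close> sets.\<close>
  define x where "x = 2 * real l * (real k + 1) * real k ^ k"
  define C where "C = root k (x * ln (threshold_base k))"
  have "x > 0" using assms k by (simp add: x_def)
  have c: "c > 0" using e L k0 by (simp add: c_def)
  have C: "C > 0" using \<open>x > 0\<close> L k0 by (simp add: C_def)
  have below: "almost_surely (\<lambda>n. random_graph n (p n)) (\<lambda>G. rainbow_index k l G > enat k)"
    if p: "\<And>n. 0 \<le> p n" "\<And>n. p n \<le> 1" and ev: "\<forall>\<^sub>F n in sequentially. p n \<le> c * threshold k n" for p
  proof (rule almost_surely_if_prob_not_le)
    define q where "q n = e / 4 * ln (real n) / real n" for n :: nat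
    define m where "m n = nat \<lfloor>real n powr e\<rfloor>" for n :: nat
    let ?b = "\<lambda>n. (real n powr e * real k) ^ 2 * q n powr (4 * e)
        + exp (- ((real n powr e - 1) * real n powr (- (e / 2))))"
    have "\<forall>\<^sub>F n in sequentially. real n powr e * real k \<le> real n"
    proof -
      have "e < 1" using k by (simp add: e_def)
      then show ?thesis using e k0 by real_asymp
    qed
    moreover have "\<forall>\<^sub>F n in sequentially. q n \<le> 1 / 2"
      unfolding q_def using e by real_asymp
    ultimately show "\<forall>\<^sub>F n in sequentially.
        measure_pmf.prob (random_graph n (p n)) {G. \<not> rainbow_index k l G > enat k} \<le> ?b n"
      using ev eventually_ge_at_top[of 1]
    proof eventually_elim
      case (elim n)
      have m: "real (m n) \<le> real n powr e" "real n powr e - 1 \<le> real (m n)"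
        by (auto simp: m_def)
      have q0: "q n \<ge> 0" using e elim by (simp add: q_def)
      have p_le: "p n \<le> root k (q n)"
        using elim mult_threshold[OF k(2), of n "e / 4"] e by (simp add: c_def q_def)
      then have "p n ^ k \<le> root k (q n) ^ k" using p by (intro power_mono) auto
      then have pk: "p n ^ k \<le> q n" using q0 k0 by simp
      \<comment> \<open>Here \<open>4 * e = 1 / k\<close>.\<close>
      have "root k (q n) = q n powr (4 * e)"
        using q0 k0 by (simp add: root_powr_inverse e_def)
      then have p_le': "p n \<le> q n powr (4 * e)" using p_le by simp
      have mk: "real (m n * k) \<le> real n powr e * real k"
        using m(1) by (simp add: mult_right_mono)
      then have mn: "m n * k \<le> n" using elim(1) by linarith
      \<comment> \<open>The probability that one fixed set has no common neighbour outside the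
        union.\<close>
      define y where "y = (1 - p n ^ k) ^ (n - m n * k)"
      have y: "y \<le> 1" "real n powr (- (e / 2)) \<le> y"
      proof -
        have pk1: "0 \<le> 1 - p n ^ k" "1 - p n ^ k \<le> 1"
          using p by (auto intro: power_le_one)
        then show "y \<le> 1" unfolding y_def by (intro power_le_one)
        have "real n powr (- (e / 2)) = exp (- (2 * q n * real n))"
          using elim by (simp add: powr_def q_def)
        also have "\<dots> \<le> (1 - q n) ^ n"
          by (rule exp_le_one_minus_power[OF q0 elim(2)])
        also have "\<dots> \<le> (1 - p n ^ k) ^ n" using pk elim(2) by (intro power_mono) auto
        also have "\<dots> \<le> y" unfolding y_def using pk1 by (intro power_decreasing) auto
        finally show "real n powr (- (e / 2)) \<le> y" .
      qed
      have "measure_pmf.prob (random_graph n (p n)) {G. \<not> rainbow_index k l G > enat k}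
          \<le> real (m n * k) ^ 2 * p n + (1 - y) ^ m n"
        unfolding y_def by (rule prob_rainbow_index_not_gt[OF k(2) assms(2) p mn])
      also have "real (m n * k) ^ 2 * p n \<le> (real n powr e * real k) ^ 2 * q n powr (4 * e)"
        by (intro mult_mono power_mono mk p_le' p) auto
      also have "(1 - y) ^ m n \<le> exp (- (y * real (m n)))"
        by (rule one_minus_power_le_exp[OF y(1)])
      also have "\<dots> \<le> exp (- ((real n powr e - 1) * real n powr (- (e / 2))))"
      proof -
        have "(real n powr e - 1) * real n powr (- (e / 2)) \<le> real (m n) * real n powr (- (e / 2))"
          using m(2) by (intro mult_right_mono) auto
        also have "\<dots> \<le> real (m n) * y" using y(2) by (intro mult_left_mono) auto
        finally show ?thesis by (simp add: mult.commute)
      qed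
      finally show ?case by simp
    qed
    \<comment> \<open>The first summand is of order \<open>n powr (- 2 * e)\<close> up to
      logarithms; the second is exponentially small in about \<open>n powr (e / 2)\<close>.\<close>
    show "?b \<longlonglongrightarrow> 0" unfolding q_def using e k0 by real_asymp
  qed
  have above: "almost_surely (\<lambda>n. random_graph n (p n)) (\<lambda>G. rainbow_index k l G \<le> enat k)"
    if p: "\<And>n. 0 \<le> p n" "\<And>n. p n \<le> 1" and ev: "\<forall>\<^sub>F n in sequentially. p n \<ge> C * threshold k n" for p
  proof (rule almost_surely_if_prob_not_le)
    show "\<forall>\<^sub>F n in sequentially.
        measure_pmf.prob (random_graph n (p n)) {G. \<not> rainbow_index k l G \<le> enat k} \<le> real l / real n"
      using ev eventually_ge_at_top[of "2 * (k + l)"]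
    proof eventually_elim
      case (elim n)
      define w where "w = (n - k) div l"
      have n: "n \<ge> 1" "n > 0" using elim k by auto
      have w: "real w \<ge> real n / (2 * real l)"
      proof -
        \<comment> \<open>Rounding down in \<open>w\<close> and removing \<open>S\<close> cost at
          most \<open>k + l\<close> vertices, which is at most \<open>n / 2\<close>; hence the
          factor 2 in \<open>x\<close>.\<close>
        have "n - k < l * (w + 1)"
          unfolding w_def using assms(2) by (metis dividend_less_div_times mult.commute mult_Suc_right
              Suc_eq_plus1 less_le_trans zero_less_one add.commute)
        then have "n \<le> 2 * l * w" using elim(2) by (simp add: algebra_simps)
        then have "real n \<le> real (2 * l * w)" by (simp only: of_nat_le_iff)
        then show ?thesis using assms(2) by (simp add: field_simps)
      qed
      define r where "r = (p n / real k) ^ k"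
      have r1: "r \<le> 1" unfolding r_def using p k by (intro power_le_one) (auto simp: field_simps intro: order_trans[OF p(2)])
      have "root k (x * ln n / n) \<le> p n"
        using elim mult_threshold[OF k(2) n(1), of x] \<open>x > 0\<close> by (simp add: C_def)
      moreover have q0: "x * ln n / n \<ge> 0" using \<open>x > 0\<close> n by simp
      ultimately have "root k (x * ln n / n) ^ k \<le> p n ^ k"
        by (intro power_mono real_root_ge_zero) auto
      then have "x * ln n / n \<le> p n ^ k" using q0 k0 by simp
      then have "x * ln n / n / real k ^ k \<le> r"
        unfolding r_def power_divide using k0 by (intro divide_right_mono) auto
      also have "x * ln n / n / real k ^ k = 2 * real l * (real k + 1) * ln n / n"
        using k0 by (simp add: x_def)
      finally have r: "2 * real l * (real k + 1) * ln n / n \<le> r" .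
      have "(real k + 1) * ln n = (2 * real l * (real k + 1) * ln n / n) * (real n / (2 * real l))"
        using n assms(2) by (simp add: field_simps)
      also have "\<dots> \<le> r * real w"
        using r w n by (intro mult_mono) (auto simp: r_def p)
      finally have rw: "(real k + 1) * ln n \<le> r * real w" .
      have "measure_pmf.prob (random_graph n (p n)) {G. \<not> rainbow_index k l G \<le> enat k}
          \<le> real n ^ k * (real l * (1 - r) ^ w)"
        unfolding r_def w_def by (rule prob_rainbow_index_not_le[OF k(1) p])
      also have "(1 - r) ^ w \<le> exp (- (r * real w))"
        by (rule one_minus_power_le_exp[OF r1])
      also have "\<dots> \<le> exp (- ((real k + 1) * ln n))" using rw by simp
      also have "\<dots> = 1 / real n ^ (k + 1)"
      proof -
        have "exp ((real k + 1) * ln n) = real n ^ (k + 1)"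
          using n by (metis Suc_eq_plus1 exp_ln exp_of_nat_mult of_nat_0_less_iff of_nat_Suc add.commute)
        then show ?thesis by (simp add: exp_minus inverse_eq_divide)
      qed
      also have "real n ^ k * (real l * (1 / real n ^ (k + 1))) = real l / real n"
        using n by (simp add: field_simps)
      finally show ?case using n by (simp add: mult_left_mono)
    qed
    show "(\<lambda>n. real l / real n) \<longlonglongrightarrow> 0" by real_asymp
  qed
  show ?thesis
    using c C below above by (intro exI[of _ c] exI[of _ C] conjI allI impI) auto
qed

end
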